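(* Let $R$ be a chained ring (commutative with nonzero identity) with maximal ideal $M$, let $\delta$ be an expansion function of ideals of $R$, and let $I$ be a proper ideal of $R$ such that $I\neq M^2$. Then $I$ is a $1$-absorbing $\delta$-primary ideal of $R$ if and only if $I$ is a $\delta$-primary ideal of $R$.
   Context: A ring $R$ is a chained ring if the set of all ideals of $R$ is linearly ordered by inclusion. $\mathcal{I}(R)$ denotes the set of all ideals of $R$. A function $\delta:\mathcal{I}(R)\to\mathcal{I}(R)$ is an expansion function of ideals of $R$ if $L\subseteq\delta(L)$ for every ideal $L$, and $J\subseteq I$ implies $\delta(J)\subseteq\delta(I)$ for all ideals $I,J$. A proper ideal $I$ of $R$ is $1$-absorbing $\delta$-primary if whenever $a,b,c\in R$ are nonunits with $abc\in I$, then $ab\in I$ or $c\in\delta(I)$. A proper ideal $I$ of $R$ is $\delta$-primary if whenever $a,b\in R$ with $ab\in I$, then $a\in I$ or $b\in\delta(I)$. *)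

theory Defs
  imports "HOL-Algebra.Algebra"
begin

definition all_ideals :: "('a, 'b) ring_scheme \<Rightarrow> 'a set set"
  where "all_ideals R = {I. ideal I R}"

text \<open>Rings are commutative with nonzero identity throughout.\<close>

locale chained_ring = cring +
  assumes one_neq_zero: "\<one> \<noteq> \<zero>"
    and ideals_linear: "\<lbrakk>I \<in> all_ideals R; J \<in> all_ideals R\<rbrakk> \<Longrightarrow> I \<subseteq> J \<or> J \<subseteq> I"

text \<open>The values of \<open>\<delta>\<close> are constrained on ideals only. The whole ring is an ideal,
  so \<open>\<delta> L\<close> may be all of \<open>carrier R\<close> even if \<open>L\<close> is proper.\<close>

definition ideal_expansion :: "('a, 'b) ring_scheme \<Rightarrow> ('a set \<Rightarrow> 'a set) \<Rightarrow> bool"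
  where "ideal_expansion R \<delta> \<longleftrightarrow>
    \<delta> \<in> all_ideals R \<rightarrow> all_ideals R \<and>
    (\<forall>L \<in> all_ideals R. L \<subseteq> \<delta> L) \<and>
    (\<forall>I \<in> all_ideals R. \<forall>J \<in> all_ideals R. J \<subseteq> I \<longrightarrow> \<delta> J \<subseteq> \<delta> I)"

definition proper_ideal :: "'a set \<Rightarrow> ('a, 'b) ring_scheme \<Rightarrow> bool"
  where "proper_ideal I R \<longleftrightarrow> ideal I R \<and> I \<noteq> carrier R"

definition one_absorbing_delta_primary ::
    "('a, 'b) ring_scheme \<Rightarrow> ('a set \<Rightarrow> 'a set) \<Rightarrow> 'a set \<Rightarrow> bool"
  where "one_absorbing_delta_primary R \<delta> I \<longleftrightarrow>
    proper_ideal I R \<and>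
    (\<forall>a \<in> carrier R - Units R. \<forall>b \<in> carrier R - Units R. \<forall>c \<in> carrier R - Units R.
      a \<otimes>\<^bsub>R\<^esub> b \<otimes>\<^bsub>R\<^esub> c \<in> I \<longrightarrow> a \<otimes>\<^bsub>R\<^esub> b \<in> I \<or> c \<in> \<delta> I)"

definition delta_primary ::
    "('a, 'b) ring_scheme \<Rightarrow> ('a set \<Rightarrow> 'a set) \<Rightarrow> 'a set \<Rightarrow> bool"
  where "delta_primary R \<delta> I \<longleftrightarrow>
    proper_ideal I R \<and>
    (\<forall>a \<in> carrier R. \<forall>b \<in> carrier R. a \<otimes>\<^bsub>R\<^esub> b \<in> I \<longrightarrow> a \<in> I \<or> b \<in> \<delta> I)"

end

theory Submission
  imports Defs
begin

text \<open>
  Suppose \<open>I\<close> is 1-absorbing \<open>\<delta>\<close>-primary but \<open>a b \<in> I\<close> with \<open>a \<notin> I\<close> and \<open>b \<notin> \<delta> I\<close>.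
  Then \<open>a\<close> and \<open>b\<close> are nonunits and \<open>M a \<subseteq> I\<close>; since \<open>I \<subseteq> R a\<close> by linearity,
  \<open>I = M a \<subseteq> M\<^sup>2\<close>. Conversely let \<open>x, y \<in> M\<close>. If \<open>x \<in> R a\<close>, then \<open>x y \<in> M a \<subseteq> I\<close>.
  Otherwise \<open>a = r x\<close> with a nonunit \<open>r\<close>, and \<open>r x b \<in> I\<close> contradicts 1-absorption.
  Hence \<open>I = M\<^sup>2\<close>.
\<close>

context chained_ring
begin

text \<open>The reverse inclusion \<open>PIdl a \<subseteq> I\<close> would put \<open>a\<close>
  into \<open>I\<close>.\<close>

lemma ideal_subset_cgenideal:
  assumes "ideal I R" and "a \<in> carrier R" and "a \<notin> I"
  shows "I \<subseteq> PIdl a"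
  using ideals_linear[of I "PIdl a"] assms cgenideal_ideal cgenideal_self
  unfolding all_ideals_def by blast

text \<open>A nonunit outside \<open>M\<close> would, by linearity, generate an ideal containing
  \<open>M\<close> strictly, hence the whole ring. This turns the nonunits in the definition of
  1-absorption into elements of \<open>M\<close>.\<close>

lemma maximalideal_eq_nonunits:
  assumes "maximalideal M R"
  shows "M = carrier R - Units R"
proof -
  interpret M: maximalideal M R by (fact assms)
  show ?thesis
  proof (intro equalityI subsetI DiffI)
    fix c assume "c \<in> M"
    then show "c \<in> carrier R" by (rule M.a_Hcarr)
    show "c \<notin> Units R"
    proof
      assume "c \<in> Units R"
      then have "inv c \<otimes> c \<in> M"
        using \<open>c \<in> M\<close> by (intro M.I_l_closed) auto
      then have "\<one> \<in> M"
        using \<open>c \<in> Units R\<close> by simp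
      then show False
        using M.one_imp_carrier M.I_notcarr by blast
    qed
  next
    fix c assume c: "c \<in> carrier R - Units R"
    have "c \<in> PIdl c"
      using c cgenideal_self by blast
    show "c \<in> M"
    proof (rule ccontr)
      assume "c \<notin> M"
      then have "M \<subseteq> PIdl c"
        using ideal_subset_cgenideal[OF M.is_ideal] c by blast
      moreover have id: "ideal (PIdl c) R"
        using c cgenideal_ideal by blast
      moreover have "PIdl c \<subseteq> carrier R"
        using id by (rule additive_subgroup.a_subset[OF ideal.axioms(1)])
      ultimately have "PIdl c = carrier R"
        using M.I_maximal \<open>c \<in> PIdl c\<close> \<open>c \<notin> M\<close> by blast
      then have "\<one> \<in> PIdl c"
        by simp
      then obtain r where "r \<in> carrier R" "r \<otimes> c = \<one>"
        unfolding cgenideal_def by auto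
      then show False
        using c unit_factor[of c r] m_comm[of r c] Units_one_closed by auto
    qed
  qed
qed

end

theorem theorem2p10:
  fixes R (structure) and M I :: "'a set" and \<delta> :: "'a set \<Rightarrow> 'a set"
  assumes "chained_ring R"
    and "maximalideal M R"
    and "ideal_expansion R \<delta>"
    and "proper_ideal I R"
    and "I \<noteq> M \<cdot> M"
  shows "one_absorbing_delta_primary R \<delta> I \<longleftrightarrow> delta_primary R \<delta> I"
proof
  interpret chained_ring R by (fact assms(1))
  assume "delta_primary R \<delta> I"
  \<comment> \<open>Apply the \<open>\<delta>\<close>-primary condition to the two factors
    \<open>a \<otimes> b\<close> and \<open>c\<close>.\<close>
  then show "one_absorbing_delta_primary R \<delta> I"
    unfolding one_absorbing_delta_primary_def delta_primary_def by blast
next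
  interpret chained_ring R by (fact assms(1))
  interpret M: maximalideal M R by (fact assms(2))
  interpret I: ideal I R using assms(4) unfolding proper_ideal_def by blast
  have M: "M = carrier R - Units R"
    using assms(2) by (rule maximalideal_eq_nonunits)
  have \<delta>: "I \<subseteq> \<delta> I"
    using assms(3) I.is_ideal unfolding ideal_expansion_def all_ideals_def by blast
  assume "one_absorbing_delta_primary R \<delta> I"
  then have absorbing: "p \<otimes> q \<in> I \<or> s \<in> \<delta> I"
    if "p \<in> M" "q \<in> M" "s \<in> M" "p \<otimes> q \<otimes> s \<in> I" for p q s
    using that M unfolding one_absorbing_delta_primary_def by blast
  have "a \<in> I \<or> b \<in> \<delta> I" if ab: "a \<in> carrier R" "b \<in> carrier R" "a \<otimes> b \<in> I" for a b
  proof (rule ccontr)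
    assume "\<not> (a \<in> I \<or> b \<in> \<delta> I)"
    then have aI: "a \<notin> I" and b\<delta>: "b \<notin> \<delta> I"
      by auto
    have unit_cancel: "v \<in> I" if "u \<in> Units R" "v \<in> carrier R" "u \<otimes> v \<in> I" for u v
      using I.I_l_closed[OF that(3), of "inv u"] that Units_closed by (simp flip: m_assoc)
    \<comment> \<open>A unit \<open>a\<close> would give \<open>b \<in> I\<close>, which lies in
      \<open>\<delta> I\<close>; a unit \<open>b\<close> would give
      \<open>a \<in> I\<close>.\<close>
    have aM: "a \<in> M"
      using unit_cancel[of a b] ab b\<delta> \<delta> M by blast
    have bM: "b \<in> M"
      using unit_cancel[of b a] ab aI M m_comm by auto
    have Ma: "c \<otimes> a \<in> I" if "c \<in> M" for c
    proof -
      have "c \<in> carrier R"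
        using that M by blast
      moreover have "c \<otimes> (a \<otimes> b) \<in> I"
        using ab(3) \<open>c \<in> carrier R\<close> by (rule I.I_l_closed)
      ultimately show ?thesis
        using absorbing[OF that aM bM] b\<delta> ab by (simp add: m_assoc)
    qed
    have "I \<subseteq> M \<cdot> M"
    proof
      fix z assume "z \<in> I"
      then obtain r where r: "r \<in> carrier R" "z = r \<otimes> a"
        using ideal_subset_cgenideal[OF I.is_ideal ab(1) aI]
        unfolding cgenideal_def by blast
      \<comment> \<open>Otherwise cancelling \<open>r\<close> in
        \<open>r \<otimes> a = z \<in> I\<close> would give \<open>a \<in> I\<close>.\<close>
      then have "r \<in> M"
        using unit_cancel[of r a] \<open>z \<in> I\<close> aI ab(1) M by blast
      then show "z \<in> M \<cdot> M"
        using r(2) aM ideal_prod.prod by metis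
    qed
    moreover have "M \<cdot> M \<subseteq> I"
    proof
      fix z assume "z \<in> M \<cdot> M"
      then show "z \<in> I"
      \<comment> \<open>\<open>M \<cdot> M\<close> is built from products by sums, and
        \<open>I\<close> is closed under sums, so only products need an argument.\<close>
      proof (induction rule: ideal_prod.induct)
        case (prod x y)
        then have carr: "x \<in> carrier R" "y \<in> carrier R"
          using M by auto
        show ?case
        proof (cases "x \<in> PIdl a")
          case True
          then obtain r where r: "r \<in> carrier R" "x = r \<otimes> a"
            unfolding cgenideal_def by blast
          \<comment> \<open>This element is \<open>x \<otimes> y\<close>, regrouped so that
            \<open>Ma\<close> applies to \<open>y\<close>.\<close>
          have "r \<otimes> (y \<otimes> a) \<in> I"
            using Ma[OF prod(2)] r(1) by (rule I.I_l_closed)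
          then show ?thesis
            using r carr ab by (simp add: m_ac)
        next
          case False
          then have "a \<in> PIdl x"
            using ideal_subset_cgenideal[OF cgenideal_ideal[OF ab(1)] carr(1)]
              cgenideal_self[OF ab(1)] by blast
          then obtain r where r: "r \<in> carrier R" "a = r \<otimes> x"
            unfolding cgenideal_def by blast
          have "r \<notin> Units R"
          proof
            assume "r \<in> Units R"
            then have "x = inv r \<otimes> a"
              using r carr by (simp flip: m_assoc)
            with \<open>r \<in> Units R\<close> False show False
              unfolding cgenideal_def by blast
          qed
          then have "r \<in> M"
            using r M by blast
          \<comment> \<open>Here \<open>r \<otimes> x \<otimes> b = a \<otimes> b \<in> I\<close>,
            so absorption yields \<open>a \<in> I\<close> or \<open>b \<in> \<delta> I\<close>, both
            excluded.\<close>
          then show ?thesis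
            using absorbing[OF _ prod(1) bM] ab(3) r(2) aI b\<delta> by blast
        qed
      next
        case (sum s1 s2)
        then show ?case by (intro I.a_closed)
      qed
    qed
    ultimately show False
      using assms(5) by blast
  qed
  then show "delta_primary R \<delta> I"
    using assms(4) unfolding delta_primary_def by blast
qed

end
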